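(* Let $L_B$ be a real random variable with density $f_{L_B}(u)=\frac{\pi}{2}\operatorname{sech}^2(\pi u)$, $u\in\mathbb{R}$. For every $x\in\mathbb{R}$, $$\log\mathfrak{B}(x):=E\log\left(x-\tfrac12+\imath L_B\right)=\psi\left(\tfrac12+\left|x-\tfrac12\right|\right).$$
   Context: $\imath$ is the imaginary unit, $\log$ is the principal branch of the complex logarithm, and $\psi=\Gamma'/\Gamma$ is the digamma function. $E$ denotes expectation: $E\,g(L_B)=\int_{\mathbb{R}}g(u)\,\frac{\pi}{2}\operatorname{sech}^2(\pi u)\,du$. For non-polynomial $h$ the nonlinear function $h(\mathfrak{B}(x))$ of the Bernoulli umbra is understood as $E\,h(x-\frac12+\imath L_B)$. *)

theory Defs
  imports "HOL-Probability.Probability"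
begin

definition sech :: "real \<Rightarrow> real" where
  "sech u = 1 / cosh u"

definition f_LB :: "real \<Rightarrow> real" where
  "f_LB u = pi / 2 * (sech (pi * u))\<^sup>2"

text \<open>
  A nonlinear function \<open>h\<close> of the Bernoulli umbra \<open>B(x)\<close>, that is
  \<open>E h(x - 1/2 + \<i> L)\<close> with the expectation \<open>E g(L)\<close> written out as the integral of \<open>g\<close>
  against the density \<open>f_LB\<close> (a Bochner integral, hence \<open>0\<close> if \<open>h\<close> is not integrable;
  integrability has to be stated separately).
\<close>

definition bernoulli_umbra :: "(complex \<Rightarrow> complex) \<Rightarrow> real \<Rightarrow> complex" where
  "bernoulli_umbra h x =
     (\<integral>u. h (complex_of_real (x - 1/2) + \<i> * complex_of_real u) * complex_of_real (f_LB u) \<partial>lborel)"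

end

theory Submission
  imports Defs
    "HOL-Real_Asymp.Real_Asymp"
    "HOL-Complex_Analysis.Cauchy_Integral_Theorem"
begin

text \<open>
  Write \<open>a = \<bar>x - 1/2\<bar>\<close>. Since the density \<open>f_LB\<close> is even and
  \<open>Ln (cnj z) = cnj (Ln z)\<close> off the branch cut, the imaginary part of the expectation vanishes,
  and the claim becomes
  \<open>J a = Digamma (a + 1/2)\<close>, where \<open>J a\<close> is the integral of \<open>ln (a\<^sup>2 + u\<^sup>2) / 2 * f_LB u\<close>.

  The density is the derivative of \<open>tanh (pi * u) / 2\<close>. Integrating by parts,
  \<open>J a - J b\<close> is the integral of \<open>(u / (b\<^sup>2 + u\<^sup>2) - u / (a\<^sup>2 + u\<^sup>2)) * tanh (pi * u) / 2\<close>.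
  Inserting the partial fractions \<open>pi * tanh (pi * u) = (\<Sum>k. 2 * u / ((k + 1/2)\<^sup>2 + u\<^sup>2))\<close>
  (lemma \<open>tanh_partial_fractions\<close>) produces, for \<open>a > b\<close>, a series of nonnegative rational
  functions, whose integrals are \<open>1 / (b + k + 1/2) - 1 / (a + k + 1/2)\<close>; their sum is
  \<open>Digamma (a + 1/2) - Digamma (b + 1/2)\<close> (lemma \<open>integral_ln_quadratic_diff\<close>). Thus
  \<open>J a - Digamma (a + 1/2)\<close> does not depend on \<open>a\<close>. It is \<open>0\<close>, because both terms are
  \<open>ln n + o(1)\<close> along the integers \<open>a = n\<close>. Half-integers \<open>a\<close>, where the partial fractions
  degenerate, and \<open>a = 0\<close> follow by monotone convergence
  (lemma \<open>has_bochner_integral_ln_quadratic_f_LB\<close>).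
\<close>

section \<open>Integrals over the real line from antiderivatives\<close>

lemma has_bochner_integral_FTC_nonneg_real_line:
  fixes f F :: "real \<Rightarrow> real"
  assumes F: "\<And>x. (F has_real_derivative f x) (at x)"
    and cont: "\<And>x. isCont f x" and nonneg: "\<And>x. 0 \<le> f x"
    and A: "(F \<longlongrightarrow> A) at_bot" and B: "(F \<longlongrightarrow> B) at_top"
  shows "has_bochner_integral lborel f (B - A)"
proof -
  have A': "((F \<circ> real_of_ereal) \<longlongrightarrow> A) (at_right (- \<infinity>))"
    and B': "((F \<circ> real_of_ereal) \<longlongrightarrow> B) (at_left \<infinity>)"
    using A B by (simp_all add: ereal_tendsto_simps)
  note FTC = interval_integral_FTC_nonneg[of "-\<infinity>" "\<infinity>", OF _ F cont _ A' B']
  have "set_integrable lborel (einterval (-\<infinity>) \<infinity>) f" "(LBINT x=-\<infinity>..\<infinity>. f x) = B - A"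
    using FTC nonneg by auto
  then show ?thesis
    by (simp add: has_bochner_integral_iff set_integrable_def interval_lebesgue_integral_def
        set_lebesgue_integral_def)
qed

lemma has_bochner_integral_FTC_real_line:
  fixes f F :: "real \<Rightarrow> real"
  assumes F: "\<And>x. (F has_real_derivative f x) (at x)"
    and cont: "\<And>x. isCont f x" and int: "integrable lborel f"
    and A: "(F \<longlongrightarrow> A) at_bot" and B: "(F \<longlongrightarrow> B) at_top"
  shows "has_bochner_integral lborel f (B - A)"
proof -
  have A': "((F \<circ> real_of_ereal) \<longlongrightarrow> A) (at_right (- \<infinity>))"
    and B': "((F \<circ> real_of_ereal) \<longlongrightarrow> B) (at_left \<infinity>)"
    using A B by (simp_all add: ereal_tendsto_simps)
  have "(LBINT x=-\<infinity>..\<infinity>. f x) = B - A"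
    by (rule interval_integral_FTC_integrable[OF _ _ cont _ A' B'])
       (use F int in \<open>simp_all add: has_real_derivative_iff_has_vector_derivative set_integrable_def\<close>)
  then show ?thesis
    using int by (simp add: has_bochner_integral_iff interval_lebesgue_integral_def
        set_lebesgue_integral_def)
qed

section \<open>A rational integral\<close>

lemma partial_fractions_three:
  fixes A B C X :: real
  assumes "A > 0" "B > 0" "C > 0" "X \<ge> 0" "A \<noteq> B" "B \<noteq> C" "A \<noteq> C"
  shows "- A / ((B - A) * (C - A)) * (1 / (A + X)) - B / ((A - B) * (C - B)) * (1 / (B + X))
           - C / ((A - C) * (B - C)) * (1 / (C + X)) = X / ((A + X) * (B + X) * (C + X))"
proof -
  have "A + X \<noteq> 0" "B + X \<noteq> 0" "C + X \<noteq> 0" "A - B \<noteq> 0" "B - C \<noteq> 0" "A - C \<noteq> 0"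
     "B - A \<noteq> 0" "C - B \<noteq> 0" "C - A \<noteq> 0"
    using assms by auto
  then show ?thesis
    by (simp add: divide_simps) algebra
qed

text \<open>
  The sum of the coefficients of \<open>arctan (u / a)\<close>, \<open>arctan (u / b)\<close>, \<open>arctan (u / c)\<close> in the
  antiderivative of \<open>u\<^sup>2 / ((a\<^sup>2 + u\<^sup>2) * (b\<^sup>2 + u\<^sup>2) * (c\<^sup>2 + u\<^sup>2))\<close>.
\<close>

lemma residue_sum_three:
  fixes a b c :: real
  assumes "a > 0" "b > 0" "c > 0" "a \<noteq> b" "b \<noteq> c" "a \<noteq> c"
  shows "- a / ((b\<^sup>2 - a\<^sup>2) * (c\<^sup>2 - a\<^sup>2)) - b / ((a\<^sup>2 - b\<^sup>2) * (c\<^sup>2 - b\<^sup>2)) - c / ((a\<^sup>2 - c\<^sup>2) * (b\<^sup>2 - c\<^sup>2))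
    = 1 / ((a + b) * (b + c) * (c + a))"
proof -
  have 1: "a\<^sup>2 - b\<^sup>2 = (a - b) * (a + b)" "b\<^sup>2 - a\<^sup>2 = (b - a) * (a + b)"
     "a\<^sup>2 - c\<^sup>2 = (a - c) * (c + a)" "c\<^sup>2 - a\<^sup>2 = (c - a) * (c + a)"
     "b\<^sup>2 - c\<^sup>2 = (b - c) * (b + c)" "c\<^sup>2 - b\<^sup>2 = (c - b) * (b + c)"
    by algebra+
  have "a + b \<noteq> 0" "b + c \<noteq> 0" "c + a \<noteq> 0" "a - b \<noteq> 0" "b - a \<noteq> 0" "a - c \<noteq> 0" "c - a \<noteq> 0"
    "b - c \<noteq> 0" "c - b \<noteq> 0"
    using assms by auto
  then show ?thesis
    unfolding 1
    by (simp add: divide_simps) algebra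
qed

lemma has_bochner_integral_square_over_three_quadratics:
  fixes a b c :: real
  assumes pos: "a > 0" "b > 0" "c > 0" and ne: "a \<noteq> b" "b \<noteq> c" "a \<noteq> c"
  shows "has_bochner_integral lborel (\<lambda>u. u\<^sup>2 / ((a\<^sup>2 + u\<^sup>2) * (b\<^sup>2 + u\<^sup>2) * (c\<^sup>2 + u\<^sup>2)))
     (pi / ((a + b) * (b + c) * (c + a)))"
proof -
  define p q r where "p = - a / ((b\<^sup>2 - a\<^sup>2) * (c\<^sup>2 - a\<^sup>2))"
    and "q = - b / ((a\<^sup>2 - b\<^sup>2) * (c\<^sup>2 - b\<^sup>2))"
    and "r = - c / ((a\<^sup>2 - c\<^sup>2) * (b\<^sup>2 - c\<^sup>2))"
  define F where "F = (\<lambda>u. p * arctan (u / a) + q * arctan (u / b) + r * arctan (u / c))"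
  have sq_ne: "a\<^sup>2 \<noteq> b\<^sup>2" "b\<^sup>2 \<noteq> c\<^sup>2" "a\<^sup>2 \<noteq> c\<^sup>2"
    using pos ne by (auto simp: power2_eq_iff)
  have d: "((\<lambda>u. arctan (u / t)) has_real_derivative t / (t\<^sup>2 + u\<^sup>2)) (at u)" if "t > 0" for t u :: real
    using that by (auto intro!: derivative_eq_intros simp: divide_simps) algebra
  have der: "(F has_real_derivative u\<^sup>2 / ((a\<^sup>2 + u\<^sup>2) * (b\<^sup>2 + u\<^sup>2) * (c\<^sup>2 + u\<^sup>2))) (at u)" for u
  proof -
    have "(F has_real_derivative p * (a / (a\<^sup>2 + u\<^sup>2)) + q * (b / (b\<^sup>2 + u\<^sup>2)) + r * (c / (c\<^sup>2 + u\<^sup>2))) (at u)"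
      unfolding F_def by (intro DERIV_add DERIV_cmult d pos)
    also have "p * (a / (a\<^sup>2 + u\<^sup>2)) + q * (b / (b\<^sup>2 + u\<^sup>2)) + r * (c / (c\<^sup>2 + u\<^sup>2)) =
        u\<^sup>2 / ((a\<^sup>2 + u\<^sup>2) * (b\<^sup>2 + u\<^sup>2) * (c\<^sup>2 + u\<^sup>2))"
      using partial_fractions_three[of "a\<^sup>2" "b\<^sup>2" "c\<^sup>2" "u\<^sup>2"] pos sq_ne
      by (simp add: p_def q_def r_def power2_eq_square)
    finally show ?thesis .
  qed
  have pos2: "t\<^sup>2 + u\<^sup>2 > 0" if "t > 0" for t u :: real
    using that by (simp add: add_pos_nonneg)
  have div_top: "filterlim (\<lambda>u. u / t) at_top at_top" and div_bot: "filterlim (\<lambda>u. u / t) at_bot at_bot"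
    if "t > 0" for t :: real
    using that by real_asymp+
  have lim1: "((\<lambda>u. arctan (u / t)) \<longlongrightarrow> pi / 2) at_top" "((\<lambda>u. arctan (u / t)) \<longlongrightarrow> - (pi / 2)) at_bot"
    if "t > 0" for t :: real
    using filterlim_compose[OF tendsto_arctan_at_top div_top[OF that]]
      filterlim_compose[OF tendsto_arctan_at_bot div_bot[OF that]] by simp_all
  have top: "(F \<longlongrightarrow> p * (pi / 2) + q * (pi / 2) + r * (pi / 2)) at_top"
    and bot: "(F \<longlongrightarrow> p * - (pi / 2) + q * - (pi / 2) + r * - (pi / 2)) at_bot"
    unfolding F_def by (intro tendsto_add tendsto_mult tendsto_const lim1 pos)+
  have "has_bochner_integral lborel (\<lambda>u. u\<^sup>2 / ((a\<^sup>2 + u\<^sup>2) * (b\<^sup>2 + u\<^sup>2) * (c\<^sup>2 + u\<^sup>2)))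
      ((p * (pi / 2) + q * (pi / 2) + r * (pi / 2))
        - (p * - (pi / 2) + q * - (pi / 2) + r * - (pi / 2)))"
    by (rule has_bochner_integral_FTC_nonneg_real_line[OF der _ _ bot top])
       (use pos2[OF pos(1)] pos2[OF pos(2)] pos2[OF pos(3)] pos in
        \<open>auto intro!: continuous_intros divide_nonneg_nonneg mult_nonneg_nonneg simp: less_imp_le sum_power2_eq_zero_iff\<close>)
  also have "(p * (pi / 2) + q * (pi / 2) + r * (pi / 2))
        - (p * - (pi / 2) + q * - (pi / 2) + r * - (pi / 2)) = pi * (p + q + r)"
    by (simp add: field_simps)
  also have "p + q + r = 1 / ((a + b) * (b + c) * (c + a))"
    using residue_sum_three[OF pos ne] by (simp add: p_def q_def r_def)
  finally show ?thesis by simp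
qed

section \<open>The partial fraction expansion of the hyperbolic tangent\<close>

lemma sums_Digamma:
  fixes z :: "'a :: {real_normed_field, banach}"
  assumes "z \<noteq> 0"
  shows "(\<lambda>k. inverse (of_nat (Suc k)) - inverse (z + of_nat k)) sums (Digamma z + euler_mascheroni)"
  using summable_sums[OF summable_Digamma[OF assms]] by (simp add: Digamma_def)

text \<open>
  Differentiating the reflection formula \<open>rGamma z * rGamma (1 - z) = sin (pi * z) / pi\<close> at
  \<open>w = 1/2 + \<i> * u\<close> expresses \<open>Digamma (1 - w) - Digamma w\<close> through \<open>tanh (pi * u)\<close>; the
  defining series of the two digamma values then gives the expansion.
\<close>

lemma tanh_partial_fractions:
  fixes u :: real
  shows "(\<lambda>k. 2 * u / ((real k + 1/2)\<^sup>2 + u\<^sup>2)) sums (pi * tanh (pi * u))"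
proof -
  define w where "w = Complex (1/2) u"
  have nz: "w \<noteq> 0" "1 - w \<noteq> 0"
    by (auto simp: w_def complex_eq_iff)
  have w: "w \<notin> \<int>\<^sub>\<le>\<^sub>0" "1 - w \<notin> \<int>\<^sub>\<le>\<^sub>0"
    using nonpos_Ints_of_int by (auto simp: w_def elim!: nonpos_Ints_cases simp: complex_eq_iff)
  have sin_w: "sin (of_real pi * w) = of_real (cosh (pi * u))"
    and cos_w: "cos (of_real pi * w) = - \<i> * of_real (sinh (pi * u))"
    by (simp_all add: w_def complex_eq_iff Re_sin Im_sin Re_cos Im_cos cosh_def sinh_def field_simps)
  have "((\<lambda>z. rGamma z * rGamma (1 - z)) has_field_derivative
      - rGamma w * Digamma w * rGamma (1 - w) + rGamma (1 - w) * Digamma (1 - w) * rGamma w) (at w)"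
    by (rule derivative_eq_intros DERIV_chain2[where g = "\<lambda>z. 1 - z"]
        has_field_derivative_rGamma_no_nonpos_int w refl | simp)+
  moreover have "((\<lambda>z. rGamma z * rGamma (1 - z)) has_field_derivative cos (of_real pi * w)) (at w)"
    unfolding rGamma_reflection_complex by (auto intro!: derivative_eq_intros)
  ultimately have "rGamma w * rGamma (1 - w) * (Digamma (1 - w) - Digamma w) = cos (of_real pi * w)"
    using DERIV_unique by (fastforce simp: algebra_simps)
  then have "Digamma (1 - w) - Digamma w = of_real pi * (cos (of_real pi * w) / sin (of_real pi * w))"
    using sin_w by (simp add: rGamma_reflection_complex field_simps)
  also have "\<dots> = - \<i> * of_real (pi * tanh (pi * u))"
    unfolding sin_w cos_w by (simp add: tanh_def)
  finally have val: "Digamma (1 - w) - Digamma w = - \<i> * of_real (pi * tanh (pi * u))" .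
  have "(\<lambda>k. (inverse (of_nat (Suc k)) - inverse (1 - w + of_nat k))
              - (inverse (of_nat (Suc k)) - inverse (w + of_nat k)))
      sums ((Digamma (1 - w) + euler_mascheroni) - (Digamma w + euler_mascheroni))"
    by (intro sums_diff sums_Digamma nz)
  then have "(\<lambda>k. inverse (w + of_nat k) - inverse (1 - w + of_nat k)) sums
      (- \<i> * of_real (pi * tanh (pi * u)))"
    using val by simp
  from sums_minus[OF sums_Im[OF this]]
  have "(\<lambda>k. - Im (inverse (w + of_nat k) - inverse (1 - w + of_nat k))) sums (pi * tanh (pi * u))"
    by simp
  also have "(\<lambda>k. - Im (inverse (w + of_nat k) - inverse (1 - w + of_nat k))) =
      (\<lambda>k. 2 * u / ((real k + 1/2)\<^sup>2 + u\<^sup>2))"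
    by (auto simp: w_def fun_eq_iff add_ac diff_divide_distrib[symmetric])
  finally show ?thesis .
qed

section \<open>The density\<close>

lemma f_LB_nonneg: "f_LB u \<ge> 0"
  by (simp add: f_LB_def)

lemma f_LB_minus: "f_LB (- u) = f_LB u"
  by (simp add: f_LB_def sech_def)

lemma isCont_f_LB: "isCont f_LB u"
  unfolding f_LB_def sech_def by (intro continuous_intros) auto

lemma borel_measurable_f_LB [measurable]: "f_LB \<in> borel_measurable borel"
  by (intro borel_measurable_continuous_onI continuous_at_imp_continuous_on ballI isCont_f_LB)

lemma DERIV_half_tanh: "((\<lambda>u. tanh (pi * u) / 2) has_real_derivative f_LB u) (at u)"
proof -
  have "1 - (tanh (pi * u))\<^sup>2 = (sech (pi * u))\<^sup>2"
    using hyperbolic_pythagoras[of "pi * u"] by (simp add: tanh_def sech_def power_divide divide_simps)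
  then show ?thesis
    by (auto intro!: derivative_eq_intros simp: f_LB_def)
qed

lemma half_tanh_limits:
  "((\<lambda>u::real. tanh (pi * u) / 2) \<longlongrightarrow> - 1 / 2) at_bot"
  "((\<lambda>u::real. tanh (pi * u) / 2) \<longlongrightarrow> 1 / 2) at_top"
proof -
  have lin: "filterlim (\<lambda>u. pi * u) at_top at_top" "filterlim (\<lambda>u. pi * u) at_bot at_bot"
    by real_asymp+
  show "((\<lambda>u::real. tanh (pi * u) / 2) \<longlongrightarrow> - 1 / 2) at_bot"
    "((\<lambda>u::real. tanh (pi * u) / 2) \<longlongrightarrow> 1 / 2) at_top"
    using tendsto_divide[OF filterlim_compose[OF tanh_real_at_bot lin(2)] tendsto_const[of 2]]
      tendsto_divide[OF filterlim_compose[OF tanh_real_at_top lin(1)] tendsto_const[of 2]]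
    by simp_all
qed

lemma has_bochner_integral_f_LB: "has_bochner_integral lborel f_LB 1"
  using has_bochner_integral_FTC_nonneg_real_line[OF DERIV_half_tanh isCont_f_LB f_LB_nonneg half_tanh_limits]
  by simp

lemma f_LB_le: "f_LB u \<le> 2 * pi / (1 + u\<^sup>2)\<^sup>2"
proof -
  have "1 + u\<^sup>2 \<le> exp \<bar>pi * u\<bar>"
  proof -
    have "2 * u\<^sup>2 \<le> (pi * u)\<^sup>2"
      using mult_right_mono[of 2 "pi\<^sup>2" "u\<^sup>2"] pi_gt3 power_mono[of 3 pi 2] by (simp add: power_mult_distrib)
    moreover have "1 + \<bar>pi * u\<bar> + \<bar>pi * u\<bar>\<^sup>2 / 2 \<le> exp \<bar>pi * u\<bar>"
      by (rule exp_lower_Taylor_quadratic) simp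
    ultimately show ?thesis
      by simp
  qed
  also have "\<dots> \<le> 2 * cosh (pi * u)"
    by (auto simp: cosh_def abs_if)
  finally have "(1 + u\<^sup>2)\<^sup>2 \<le> (2 * cosh (pi * u))\<^sup>2"
    by (intro power_mono) auto
  then have "1 / (cosh (pi * u))\<^sup>2 \<le> 4 / (1 + u\<^sup>2)\<^sup>2"
    by (simp add: power_mult_distrib divide_simps) (auto simp: add_nonneg_eq_0_iff)
  from mult_left_mono[OF this, of "pi / 2"] show ?thesis
    by (simp add: f_LB_def sech_def power_divide)
qed

lemma integrable_square_f_LB: "integrable lborel (\<lambda>u. u\<^sup>2 * f_LB u)"
proof (rule Bochner_Integration.integrable_bound)
  show "integrable lborel (\<lambda>u. 2 * pi * inverse (1 + u\<^sup>2))"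
    using integrable_inverse_1_plus_square by (simp add: set_integrable_def)
  show "AE u in lborel. norm (u\<^sup>2 * f_LB u) \<le> norm (2 * pi * inverse (1 + u\<^sup>2))"
  proof (intro AE_I2)
    fix u :: real
    have pos: "1 + u\<^sup>2 > 0" by (simp add: add_pos_nonneg)
    have "u\<^sup>2 * f_LB u \<le> (1 + u\<^sup>2) * (2 * pi / (1 + u\<^sup>2)\<^sup>2)"
      by (intro mult_mono f_LB_le f_LB_nonneg) auto
    also have "\<dots> = 2 * pi * inverse (1 + u\<^sup>2)"
      using pos by (simp add: power2_eq_square[of "1 + u\<^sup>2"] inverse_eq_divide del: power2_eq_square)
    finally show "norm (u\<^sup>2 * f_LB u) \<le> norm (2 * pi * inverse (1 + u\<^sup>2))"
      using f_LB_nonneg[of u] by simp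
  qed
qed measurable


section \<open>Differences of the logarithmic integral\<close>

text \<open>
  The expansion of \<open>tanh\<close> turns the integrand into a series of nonnegative rational functions
  with poles at \<open>\<plusminus> \<i> * a\<close>, \<open>\<plusminus> \<i> * b\<close> and \<open>\<plusminus> \<i> * (k + 1/2)\<close>. Integrating term by term gives
  \<open>1 / (b + k + 1/2) - 1 / (a + k + 1/2)\<close>. Half-integers \<open>a\<close> and \<open>b\<close> are excluded so that all
  poles are simple.
\<close>

lemma has_bochner_integral_tanh_kernel:
  fixes a b :: real
  assumes b: "0 < b" and ab: "b < a"
    and half: "\<And>k::nat. a \<noteq> real k + 1/2" "\<And>k::nat. b \<noteq> real k + 1/2"
  shows "has_bochner_integral lborel
           (\<lambda>u. (u / (b\<^sup>2 + u\<^sup>2) - u / (a\<^sup>2 + u\<^sup>2)) * (tanh (pi * u) / 2))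
           (Digamma (a + 1/2) - Digamma (b + 1/2))"
proof -
  define g where "g = (\<lambda>(k::nat) u::real. (a\<^sup>2 - b\<^sup>2) / pi *
    (u\<^sup>2 / ((a\<^sup>2 + u\<^sup>2) * (b\<^sup>2 + u\<^sup>2) * ((real k + 1/2)\<^sup>2 + u\<^sup>2))))"
  define I where "I = (\<lambda>k::nat. inverse (b + 1/2 + real k) - inverse (a + 1/2 + real k))"
  have a: "0 < a" using b ab by simp
  have pos: "a\<^sup>2 + u\<^sup>2 > 0" "b\<^sup>2 + u\<^sup>2 > 0" for u :: real
    using a b by (simp_all add: add_pos_nonneg)
  have g_int: "has_bochner_integral lborel (g k) (I k)" for k
  proof -
    define c where "c = real k + 1/2"
    have c: "c > 0" by (simp add: c_def)
    have "has_bochner_integral lborel (g k) ((a\<^sup>2 - b\<^sup>2) / pi * (pi / ((a + b) * (b + c) * (c + a))))"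
      unfolding g_def c_def[symmetric] using half[of k] ab a b c
      by (intro has_bochner_integral_mult_right has_bochner_integral_square_over_three_quadratics)
         (auto simp: c_def)
    also have "a\<^sup>2 - b\<^sup>2 = (a + b) * (a - b)"
      by algebra
    also have "(a + b) * (a - b) / pi * (pi / ((a + b) * (b + c) * (c + a))) = inverse (b + c) - inverse (a + c)"
      using a b c by (simp add: divide_simps)
    finally show ?thesis
      by (simp add: I_def c_def add_ac)
  qed
  have I_sums: "I sums (Digamma (a + 1/2) - Digamma (b + 1/2))"
    using sums_diff[OF sums_Digamma[of "a + 1/2"] sums_Digamma[of "b + 1/2"]] a b
    by (simp add: I_def)
  have g_nonneg: "g k u \<ge> 0" for k u
    using ab b pos[of u] unfolding g_def
    by (intro mult_nonneg_nonneg divide_nonneg_nonneg) (auto intro: power_mono)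
  have g_sums: "(\<lambda>k. g k u) sums ((u / (b\<^sup>2 + u\<^sup>2) - u / (a\<^sup>2 + u\<^sup>2)) * (tanh (pi * u) / 2))" for u
  proof -
    have "(\<lambda>k. (a\<^sup>2 - b\<^sup>2) / pi * u / (2 * ((a\<^sup>2 + u\<^sup>2) * (b\<^sup>2 + u\<^sup>2))) * (2 * u / ((real k + 1/2)\<^sup>2 + u\<^sup>2)))
        sums ((a\<^sup>2 - b\<^sup>2) / pi * u / (2 * ((a\<^sup>2 + u\<^sup>2) * (b\<^sup>2 + u\<^sup>2))) * (pi * tanh (pi * u)))"
      by (intro sums_mult tanh_partial_fractions)
    also have "(\<lambda>k. (a\<^sup>2 - b\<^sup>2) / pi * u / (2 * ((a\<^sup>2 + u\<^sup>2) * (b\<^sup>2 + u\<^sup>2))) *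
        (2 * u / ((real k + 1/2)\<^sup>2 + u\<^sup>2))) = (\<lambda>k. g k u)"
      by (simp add: g_def fun_eq_iff power2_eq_square[of u])
    also have "(a\<^sup>2 - b\<^sup>2) / pi * u / (2 * ((a\<^sup>2 + u\<^sup>2) * (b\<^sup>2 + u\<^sup>2))) * (pi * tanh (pi * u)) =
        ((a\<^sup>2 - b\<^sup>2) * u / ((a\<^sup>2 + u\<^sup>2) * (b\<^sup>2 + u\<^sup>2))) * (tanh (pi * u) / 2)"
      by (simp add: ac_simps)
    also have "(a\<^sup>2 - b\<^sup>2) * u / ((a\<^sup>2 + u\<^sup>2) * (b\<^sup>2 + u\<^sup>2)) = u / (b\<^sup>2 + u\<^sup>2) - u / (a\<^sup>2 + u\<^sup>2)"
      using pos[of u] by (subst diff_frac_eq) (auto simp: algebra_simps)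
    finally show ?thesis .
  qed
  have prems: "\<And>k. integrable lborel (g k)" "AE u in lborel. summable (\<lambda>k. norm (g k u))"
     "summable (\<lambda>k. \<integral>u. norm (g k u) \<partial>lborel)"
    using g_int g_sums I_sums g_nonneg
    by (auto simp: has_bochner_integral_iff sums_iff)
  have "(\<lambda>u. \<Sum>k. g k u) = (\<lambda>u. (u / (b\<^sup>2 + u\<^sup>2) - u / (a\<^sup>2 + u\<^sup>2)) * (tanh (pi * u) / 2))"
    by (intro ext sums_unique[symmetric] g_sums)
  moreover have "has_bochner_integral lborel (\<lambda>u. \<Sum>k. g k u) (\<Sum>k. I k)"
    using integrable_suminf[OF prems] integral_suminf[OF prems] g_int
    by (simp add: has_bochner_integral_iff)
  moreover have "(\<Sum>k. I k) = Digamma (a + 1/2) - Digamma (b + 1/2)"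
    using I_sums by (simp add: sums_iff)
  ultimately show ?thesis by simp
qed

lemma ln_quadratic_bounds:
  fixes a u :: real
  assumes "a > 0"
  shows "ln a \<le> ln (a\<^sup>2 + u\<^sup>2) / 2" "ln (a\<^sup>2 + u\<^sup>2) / 2 \<le> ln a + u\<^sup>2 / (2 * a\<^sup>2)"
proof -
  have pos: "1 + u\<^sup>2 / a\<^sup>2 > 0" by (simp add: add_pos_nonneg)
  have "ln (a\<^sup>2 + u\<^sup>2) = ln (a\<^sup>2 * (1 + u\<^sup>2 / a\<^sup>2))"
    using assms by (simp add: distrib_left)
  also have "\<dots> = 2 * ln a + ln (1 + u\<^sup>2 / a\<^sup>2)"
    using assms pos by (simp add: ln_mult ln_realpow)
  finally have eq: "ln (a\<^sup>2 + u\<^sup>2) = 2 * ln a + ln (1 + u\<^sup>2 / a\<^sup>2)" .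
  show "ln a \<le> ln (a\<^sup>2 + u\<^sup>2) / 2"
    unfolding eq by simp
  show "ln (a\<^sup>2 + u\<^sup>2) / 2 \<le> ln a + u\<^sup>2 / (2 * a\<^sup>2)"
    unfolding eq using ln_add_one_self_le_self[of "u\<^sup>2 / a\<^sup>2"] by simp
qed

lemma integrable_ln_quadratic_f_LB:
  fixes a :: real
  assumes "a > 0"
  shows "integrable lborel (\<lambda>u. ln (a\<^sup>2 + u\<^sup>2) / 2 * f_LB u)"
proof (rule Bochner_Integration.integrable_bound)
  show "integrable lborel (\<lambda>u. \<bar>ln a\<bar> * f_LB u + 1 / (2 * a\<^sup>2) * (u\<^sup>2 * f_LB u))"
    using has_bochner_integral_f_LB
    by (intro Bochner_Integration.integrable_add integrable_mult_right integrable_square_f_LB)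
       (simp add: has_bochner_integral_iff)
  show "AE u in lborel. norm (ln (a\<^sup>2 + u\<^sup>2) / 2 * f_LB u)
      \<le> norm (\<bar>ln a\<bar> * f_LB u + 1 / (2 * a\<^sup>2) * (u\<^sup>2 * f_LB u))"
  proof (intro AE_I2)
    fix u :: real
    have "\<bar>ln (a\<^sup>2 + u\<^sup>2) / 2\<bar> \<le> \<bar>ln a\<bar> + u\<^sup>2 / (2 * a\<^sup>2)"
      using ln_quadratic_bounds[OF assms, of u] zero_le_divide_iff[of "u\<^sup>2" "2 * a\<^sup>2"]
      by (smt (verit) zero_le_power2)
    from mult_right_mono[OF this f_LB_nonneg[of u]]
    show "norm (ln (a\<^sup>2 + u\<^sup>2) / 2 * f_LB u)
      \<le> norm (\<bar>ln a\<bar> * f_LB u + 1 / (2 * a\<^sup>2) * (u\<^sup>2 * f_LB u))"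
      using f_LB_nonneg[of u] by (simp add: abs_mult algebra_simps)
  qed
qed measurable

text \<open>
  Integration by parts against \<open>tanh (pi * u) / 2\<close>, an antiderivative of the density. Only the
  difference for two parameters has vanishing boundary terms.
\<close>

lemma integral_ln_quadratic_diff:
  fixes a b :: real
  assumes b: "0 < b" and ab: "b < a"
    and half: "\<And>k::nat. a \<noteq> real k + 1/2" "\<And>k::nat. b \<noteq> real k + 1/2"
  shows "(\<integral>u. ln (a\<^sup>2 + u\<^sup>2) / 2 * f_LB u \<partial>lborel) - (\<integral>u. ln (b\<^sup>2 + u\<^sup>2) / 2 * f_LB u \<partial>lborel) =
     Digamma (a + 1/2) - Digamma (b + 1/2)"
proof -
  have a: "0 < a" using b ab by simp
  have pos: "t\<^sup>2 + u\<^sup>2 > 0" if "t > 0" for t u :: real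
    using that by (simp add: add_pos_nonneg)
  define h where "h = (\<lambda>u. (u / (b\<^sup>2 + u\<^sup>2) - u / (a\<^sup>2 + u\<^sup>2)) * (tanh (pi * u) / 2))"
  define l where "l = (\<lambda>u. ln (a\<^sup>2 + u\<^sup>2) / 2 - ln (b\<^sup>2 + u\<^sup>2) / 2)"
  have h: "has_bochner_integral lborel h (Digamma (a + 1/2) - Digamma (b + 1/2))"
    unfolding h_def by (rule has_bochner_integral_tanh_kernel[OF assms])
  have l: "has_bochner_integral lborel (\<lambda>u. l u * f_LB u)
     ((\<integral>u. ln (a\<^sup>2 + u\<^sup>2) / 2 * f_LB u \<partial>lborel) - (\<integral>u. ln (b\<^sup>2 + u\<^sup>2) / 2 * f_LB u \<partial>lborel))"
    unfolding l_def left_diff_distrib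
    by (intro has_bochner_integral_diff has_bochner_integral_integrable integrable_ln_quadratic_f_LB a b)
  have d: "((\<lambda>u. ln (t\<^sup>2 + u\<^sup>2) / 2) has_real_derivative u / (t\<^sup>2 + u\<^sup>2)) (at u)" if "t > 0" for t u :: real
    using pos[OF that, of u] by (auto intro!: derivative_eq_intros simp: divide_simps)
  have dl: "(l has_real_derivative (u / (a\<^sup>2 + u\<^sup>2) - u / (b\<^sup>2 + u\<^sup>2))) (at u)" for u
    unfolding l_def by (intro DERIV_diff d a b)
  have der: "((\<lambda>u. l u * (tanh (pi * u) / 2)) has_real_derivative l u * f_LB u - h u) (at u)" for u
    using DERIV_mult[OF dl[of u] DERIV_half_tanh[of u]] by (simp add: h_def algebra_simps)
  have cont: "isCont (\<lambda>u. l u * f_LB u - h u) u" for u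
    unfolding h_def l_def using pos[OF a, of u] pos[OF b, of u]
    by (auto intro!: continuous_intros isCont_f_LB)
  have lim: "((\<lambda>u. l u * (tanh (pi * u) / 2)) \<longlongrightarrow> 0 * (1 / 2)) at_top"
    "((\<lambda>u. l u * (tanh (pi * u) / 2)) \<longlongrightarrow> 0 * (- 1 / 2)) at_bot"
  proof -
    have l_lim: "(l \<longlongrightarrow> 0) at_top" "(l \<longlongrightarrow> 0) at_bot"
      unfolding l_def by real_asymp+
    show "((\<lambda>u. l u * (tanh (pi * u) / 2)) \<longlongrightarrow> 0 * (1 / 2)) at_top"
      "((\<lambda>u. l u * (tanh (pi * u) / 2)) \<longlongrightarrow> 0 * (- 1 / 2)) at_bot"
      by (fact tendsto_mult[OF l_lim(1) half_tanh_limits(2)] tendsto_mult[OF l_lim(2) half_tanh_limits(1)])+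
  qed
  have "integrable lborel (\<lambda>u. l u * f_LB u - h u)"
    using has_bochner_integral_diff[OF l h] by (simp add: has_bochner_integral_iff)
  from has_bochner_integral_FTC_real_line[OF der cont this lim(2) lim(1)]
  have "has_bochner_integral lborel (\<lambda>u. l u * f_LB u - h u) 0"
    by simp
  with has_bochner_integral_diff[OF l h] show ?thesis
    by (simp add: has_bochner_integral_iff)
qed

section \<open>Evaluation of the logarithmic integral\<close>

lemma Digamma_asymptotics: "(\<lambda>n. ln (real n) - Digamma (real n + 1/2)) \<longlonglongrightarrow> 0"
proof (rule tendsto_sandwich)
  have D: "Digamma (real n + 1) = harm n - euler_mascheroni" for n
    using Digamma_of_nat[of n, where 'a = real] by (simp add: add_ac)
  have lo: "(\<lambda>n. - (harm n - ln (real n)) + euler_mascheroni) \<longlonglongrightarrow> 0"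
    by (rule tendsto_eq_intros euler_mascheroni_LIMSEQ refl | simp)+
  then show lo': "(\<lambda>n. ln (real n) - Digamma (real n + 1)) \<longlonglongrightarrow> 0"
    unfolding D by (simp add: algebra_simps)
  have "(\<lambda>n. ln (real n) - Digamma (real n + 1) + 1 / real n) \<longlonglongrightarrow> 0 + 0"
    by (intro tendsto_add lo' lim_1_over_n)
  then show "(\<lambda>n. ln (real n) - Digamma (real n + 1) + 1 / real n) \<longlonglongrightarrow> 0" by simp
  show "\<forall>\<^sub>F n in sequentially. ln (real n) - Digamma (real n + 1) \<le> ln (real n) - Digamma (real n + 1/2)"
    by (intro always_eventually allI diff_left_mono Digamma_real_mono) auto
  show "\<forall>\<^sub>F n in sequentially. ln (real n) - Digamma (real n + 1/2)
      \<le> ln (real n) - Digamma (real n + 1) + 1 / real n"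
    using eventually_gt_at_top[of 0]
  proof eventually_elim
    case (elim n)
    then show ?case
      using Digamma_plus1[of "real n"] Digamma_real_mono[of "real n" "real n + 1/2"] by simp
  qed
qed

lemma integral_ln_quadratic_asymptotics:
  "(\<lambda>n. (\<integral>u. ln ((real n)\<^sup>2 + u\<^sup>2) / 2 * f_LB u \<partial>lborel) - ln (real n)) \<longlonglongrightarrow> 0"
proof (rule tendsto_sandwich)
  define s where "s = (\<integral>u. u\<^sup>2 * f_LB u \<partial>lborel)"
  have f: "integrable lborel f_LB" "integral\<^sup>L lborel f_LB = 1"
    using has_bochner_integral_f_LB by (auto simp: has_bochner_integral_iff)
  show "(\<lambda>n. 0) \<longlonglongrightarrow> (0::real)" by simp
  show "(\<lambda>n. 1 / (2 * (real n)\<^sup>2) * s) \<longlonglongrightarrow> 0"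
    by real_asymp
  show "\<forall>\<^sub>F n in sequentially. 0 \<le> (\<integral>u. ln ((real n)\<^sup>2 + u\<^sup>2) / 2 * f_LB u \<partial>lborel) - ln (real n)"
    using eventually_gt_at_top[of 0]
  proof eventually_elim
    case (elim n)
    have "(\<integral>u. ln (real n) * f_LB u \<partial>lborel) \<le> (\<integral>u. ln ((real n)\<^sup>2 + u\<^sup>2) / 2 * f_LB u \<partial>lborel)"
      using elim f by (intro integral_mono integrable_mult_right integrable_ln_quadratic_f_LB
          mult_right_mono ln_quadratic_bounds f_LB_nonneg) auto
    then show ?case using f by simp
  qed
  show "\<forall>\<^sub>F n in sequentially. (\<integral>u. ln ((real n)\<^sup>2 + u\<^sup>2) / 2 * f_LB u \<partial>lborel) - ln (real n)
      \<le> 1 / (2 * (real n)\<^sup>2) * s"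
    using eventually_gt_at_top[of 0]
  proof eventually_elim
    case (elim n)
    have "(\<integral>u. ln ((real n)\<^sup>2 + u\<^sup>2) / 2 * f_LB u \<partial>lborel)
        \<le> (\<integral>u. ln (real n) * f_LB u + 1 / (2 * (real n)\<^sup>2) * (u\<^sup>2 * f_LB u) \<partial>lborel)"
    proof (intro integral_mono Bochner_Integration.integrable_add integrable_mult_right
        integrable_ln_quadratic_f_LB f integrable_square_f_LB)
      fix u :: real
      show "ln ((real n)\<^sup>2 + u\<^sup>2) / 2 * f_LB u
          \<le> ln (real n) * f_LB u + 1 / (2 * (real n)\<^sup>2) * (u\<^sup>2 * f_LB u)"
        using mult_right_mono[OF ln_quadratic_bounds(2)[of "real n" u] f_LB_nonneg[of u]] elim
        by (simp add: algebra_simps)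
    qed (use elim in simp)
    also have "\<dots> = ln (real n) + 1 / (2 * (real n)\<^sup>2) * s"
      unfolding s_def using f integrable_square_f_LB
      by (subst Bochner_Integration.integral_add) auto
    finally show ?case by simp
  qed
qed

text \<open>
  By the difference formula, the two sides differ by the same constant at \<open>b\<close> and at every
  integer \<open>n > b\<close>; this constant is \<open>0\<close> because it tends to \<open>0\<close> as \<open>n\<close> grows.
\<close>

lemma integral_ln_quadratic_generic:
  fixes b :: real
  assumes b: "0 < b" and half: "\<And>k::nat. b \<noteq> real k + 1/2"
  shows "(\<integral>u. ln (b\<^sup>2 + u\<^sup>2) / 2 * f_LB u \<partial>lborel) = Digamma (b + 1/2)"
proof -
  define J where "J = (\<lambda>a. (\<integral>u. ln (a\<^sup>2 + u\<^sup>2) / 2 * f_LB u \<partial>lborel))"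
  have nat_half: "real n \<noteq> real k + 1/2" for n k :: nat
  proof
    assume "real n = real k + 1/2"
    then have "real (2 * n) = real (2 * k + 1)" by simp
    then have "2 * n = 2 * k + 1" by (rule of_nat_eq_iff[THEN iffD1])
    then show False by presburger
  qed
  have "(\<lambda>n. J (real n) - Digamma (real n + 1/2)) \<longlonglongrightarrow> 0"
    using tendsto_add[OF integral_ln_quadratic_asymptotics Digamma_asymptotics] by (simp add: J_def)
  moreover have "\<forall>\<^sub>F n in sequentially. J (real n) - Digamma (real n + 1/2) = J b - Digamma (b + 1/2)"
    using eventually_gt_at_top[of "nat \<lceil>b\<rceil>"]
  proof eventually_elim
    case (elim n)
    then have "b < real n" by linarith
    from integral_ln_quadratic_diff[OF b this nat_half half] show ?case
      by (simp add: J_def algebra_simps)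
  qed
  ultimately have "(\<lambda>n::nat. J b - Digamma (b + 1/2)) \<longlonglongrightarrow> 0"
    by (rule Lim_transform_eventually)
  then show ?thesis by (simp add: J_def LIMSEQ_const_iff)
qed

text \<open>
  Half-integers \<open>a\<close> and \<open>a = 0\<close> are reached from above by monotone convergence, which at
  \<open>a = 0\<close> also yields the integrability of the logarithmic singularity.
\<close>

lemma has_bochner_integral_ln_quadratic_f_LB:
  fixes a :: real
  assumes a: "a \<ge> 0"
  shows "has_bochner_integral lborel (\<lambda>u. ln (a\<^sup>2 + u\<^sup>2) / 2 * f_LB u) (Digamma (a + 1/2))"
proof -
  \<comment> \<open>The first half-integer above \<open>a\<close> is \<open>a + \<delta>\<close>, so the sequence \<open>s\<close> avoids half-integers.\<close>
  define \<delta> where "\<delta> = of_int \<lfloor>a + 1/2\<rfloor> + 1/2 - a"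
  have \<delta>: "\<delta> > 0" unfolding \<delta>_def by linarith
  define s where "s = (\<lambda>n::nat. a + \<delta> / (real n + 2))"
  have s_gt: "s n > a" for n using \<delta> by (simp add: s_def)
  have s_pos: "s n > 0" for n using s_gt[of n] a by simp
  have s_half: "s n \<noteq> real k + 1/2" for n k
  proof
    assume eq: "s n = real k + 1/2"
    have "\<delta> / (real n + 2) < \<delta>" using \<delta> by (simp add: divide_less_eq)
    then have "s n < of_int \<lfloor>a + 1/2\<rfloor> + 1/2" by (simp add: s_def \<delta>_def)
    then have "int k < \<lfloor>a + 1/2\<rfloor>" using eq by linarith
    then show False using s_gt[of n] eq by linarith
  qed
  have s_anti: "s n \<le> s m" if "m \<le> n" for m n
    using that \<delta> by (simp add: s_def frac_le)
  have s_lim: "s \<longlonglongrightarrow> a" unfolding s_def by real_asymp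
  have "has_bochner_integral lborel (\<lambda>u. - (ln (a\<^sup>2 + u\<^sup>2) / 2 * f_LB u)) (- Digamma (a + 1/2))"
  proof (rule has_bochner_integral_monotone_convergence)
    show "integrable lborel (\<lambda>u. - (ln ((s n)\<^sup>2 + u\<^sup>2) / 2 * f_LB u))" for n
      using integrable_ln_quadratic_f_LB[OF s_pos] by simp
    show "AE u in lborel. mono (\<lambda>n. - (ln ((s n)\<^sup>2 + u\<^sup>2) / 2 * f_LB u))"
    proof (intro AE_I2 monoI)
      fix u and m n :: nat
      assume "m \<le> n"
      then have "(s n)\<^sup>2 \<le> (s m)\<^sup>2" using s_anti s_pos[of n] by (intro power_mono) (auto intro: less_imp_le)
      moreover have "(s n)\<^sup>2 + u\<^sup>2 > 0" using s_pos[of n] by (simp add: add_pos_nonneg)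
      ultimately have "ln ((s n)\<^sup>2 + u\<^sup>2) / 2 * f_LB u \<le> ln ((s m)\<^sup>2 + u\<^sup>2) / 2 * f_LB u"
        by (intro mult_right_mono f_LB_nonneg) simp
      then show "- (ln ((s m)\<^sup>2 + u\<^sup>2) / 2 * f_LB u) \<le> - (ln ((s n)\<^sup>2 + u\<^sup>2) / 2 * f_LB u)" by simp
    qed
    show "AE u in lborel. (\<lambda>n. - (ln ((s n)\<^sup>2 + u\<^sup>2) / 2 * f_LB u)) \<longlonglongrightarrow> - (ln (a\<^sup>2 + u\<^sup>2) / 2 * f_LB u)"
      using AE_lborel_singleton[of 0]
    proof eventually_elim
      case (elim u)
      then have "a\<^sup>2 + u\<^sup>2 \<noteq> 0" by (simp add: sum_power2_eq_zero_iff)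
      then show ?case by (intro tendsto_intros s_lim) auto
    qed
    have "(\<lambda>n. Digamma (s n + 1/2)) \<longlonglongrightarrow> Digamma (a + 1/2)"
      using a by (intro isCont_tendsto_compose[OF isCont_Polygamma] tendsto_intros s_lim)
         (auto elim!: nonpos_Ints_cases)
    then show "(\<lambda>n. \<integral>u. - (ln ((s n)\<^sup>2 + u\<^sup>2) / 2 * f_LB u) \<partial>lborel) \<longlonglongrightarrow> - Digamma (a + 1/2)"
      using integral_ln_quadratic_generic[OF s_pos s_half] by (auto intro: tendsto_minus)
  qed measurable
  from has_bochner_integral_minus[OF this] show ?thesis by simp
qed

section \<open>The complex logarithm\<close>

text \<open>
  The point \<open>u = 0\<close>, where the argument lies on the real axis, is a null set. Away from it the
  substitution \<open>u \<mapsto> - u\<close> conjugates the logarithm, so the imaginary part integrates to \<open>0\<close>.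
\<close>

lemma has_bochner_integral_Ln_f_LB:
  fixes d :: real
  shows "has_bochner_integral lborel
     (\<lambda>u. f_LB u *\<^sub>R Ln (complex_of_real d + \<i> * complex_of_real u))
     (complex_of_real (Digamma (1/2 + \<bar>d\<bar>)))"
proof -
  define G where "G = (\<lambda>u. f_LB u *\<^sub>R Ln (complex_of_real d + \<i> * complex_of_real u))"
  have G [measurable]: "G \<in> borel_measurable borel" unfolding G_def by measurable
  have [measurable]: "(\<lambda>u. cnj (G u)) \<in> borel_measurable borel"
    by (rule measurable_compose[OF G borel_measurable_continuous_onI]) (intro continuous_intros)
  have main: "has_bochner_integral lborel (\<lambda>u. ln (d\<^sup>2 + u\<^sup>2) / 2 * f_LB u) (Digamma (1/2 + \<bar>d\<bar>))"
    using has_bochner_integral_ln_quadratic_f_LB[of "\<bar>d\<bar>"] by (simp add: add.commute)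
  have nz: "complex_of_real d + \<i> * complex_of_real u \<noteq> 0" if "u \<noteq> 0" for u
    using that by (auto simp: complex_eq_iff)
  have Re_Ln: "Re (Ln (complex_of_real d + \<i> * complex_of_real u)) = ln (d\<^sup>2 + u\<^sup>2) / 2" if "u \<noteq> 0" for u
  proof -
    have "d\<^sup>2 + u\<^sup>2 > 0" using that by (simp add: add_nonneg_pos)
    then show ?thesis
      by (subst Re_Ln[OF nz[OF that]]) (simp add: cmod_def ln_sqrt)
  qed
  have AE_Re: "AE u in lborel. Re (G u) = ln (d\<^sup>2 + u\<^sup>2) / 2 * f_LB u"
    using AE_lborel_singleton[of 0] by eventually_elim (simp add: G_def Re_Ln)
  have int: "integrable lborel G"
  proof (rule Bochner_Integration.integrable_bound)
    show "integrable lborel (\<lambda>u. \<bar>ln (d\<^sup>2 + u\<^sup>2) / 2 * f_LB u\<bar> + pi * f_LB u)"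
      using main has_bochner_integral_f_LB
      by (intro Bochner_Integration.integrable_add integrable_abs integrable_mult_right)
         (auto simp: has_bochner_integral_iff)
    show "AE u in lborel. norm (G u) \<le> norm (\<bar>ln (d\<^sup>2 + u\<^sup>2) / 2 * f_LB u\<bar> + pi * f_LB u)"
      using AE_lborel_singleton[of 0]
    proof eventually_elim
      case (elim u)
      define L where "L = Ln (complex_of_real d + \<i> * complex_of_real u)"
      have "\<bar>Im L\<bar> \<le> pi"
        using mpi_less_Im_Ln[OF nz[OF elim]] Im_Ln_le_pi[OF nz[OF elim]] by (simp add: L_def)
      then have "norm L \<le> \<bar>ln (d\<^sup>2 + u\<^sup>2) / 2\<bar> + pi"
        using cmod_le[of L] Re_Ln[OF elim] by (simp add: L_def)
      from mult_right_mono[OF this f_LB_nonneg[of u]] show ?case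
        using f_LB_nonneg[of u] by (simp add: G_def L_def[symmetric] abs_mult algebra_simps)
    qed
  qed measurable
  have "integral\<^sup>L lborel G = (\<integral>u. G (- u) \<partial>lborel)"
    using lborel_integral_real_affine[of "-1" G 0] by simp
  also have "\<dots> = (\<integral>u. cnj (G u) \<partial>lborel)"
  proof (rule integral_cong_AE)
    show "AE u in lborel. G (- u) = cnj (G u)"
      using AE_lborel_singleton[of 0]
    proof eventually_elim
      case (elim u)
      then have "complex_of_real d + \<i> * complex_of_real u \<notin> \<real>\<^sub>\<le>\<^sub>0"
        by (simp add: complex_nonpos_Reals_iff)
      from cnj_Ln[OF this] show ?case
        by (simp add: G_def f_LB_minus)
    qed
  qed measurable
  also have "\<dots> = cnj (integral\<^sup>L lborel G)" by simp
  finally have "integral\<^sup>L lborel G = of_real (Re (integral\<^sup>L lborel G))"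
    by (simp add: complex_eq_iff)
  also have "Re (integral\<^sup>L lborel G) = (\<integral>u. Re (G u) \<partial>lborel)"
    using int by simp
  also have "\<dots> = (\<integral>u. ln (d\<^sup>2 + u\<^sup>2) / 2 * f_LB u \<partial>lborel)"
    by (rule integral_cong_AE[OF _ _ AE_Re]) measurable
  finally show ?thesis
    using int main unfolding G_def[symmetric] by (simp add: has_bochner_integral_iff)
qed

theorem mainTheorem2:
  fixes M :: "'a measure" and L :: "'a \<Rightarrow> real" and x :: real
  assumes "prob_space M"
    and "distributed M lborel L (\<lambda>u. ennreal (f_LB u))"
  shows "integrable M (\<lambda>\<omega>. Ln (complex_of_real (x - 1/2) + \<i> * complex_of_real (L \<omega>)))
    \<and> bernoulli_umbra Ln x =
        prob_space.expectation M (\<lambda>\<omega>. Ln (complex_of_real (x - 1/2) + \<i> * complex_of_real (L \<omega>)))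
    \<and> prob_space.expectation M (\<lambda>\<omega>. Ln (complex_of_real (x - 1/2) + \<i> * complex_of_real (L \<omega>))) =
        complex_of_real (Digamma (1/2 + \<bar>x - 1/2\<bar>))"
proof -
  define g where "g = (\<lambda>u. Ln (complex_of_real (x - 1/2) + \<i> * complex_of_real u))"
  have g[measurable]: "g \<in> borel_measurable borel" unfolding g_def by measurable
  have L[measurable]: "L \<in> borel_measurable M"
    using assms(2) by (simp add: distributed_def)
  have distr: "distr M lborel L = density lborel (\<lambda>u. ennreal (f_LB u))"
    using assms(2) by (simp add: distributed_def)
  have main: "has_bochner_integral lborel (\<lambda>u. f_LB u *\<^sub>R g u) (complex_of_real (Digamma (1/2 + \<bar>x - 1/2\<bar>)))"
    unfolding g_def by (rule has_bochner_integral_Ln_f_LB)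
  have "has_bochner_integral (density lborel (\<lambda>u. ennreal (f_LB u))) g (complex_of_real (Digamma (1/2 + \<bar>x - 1/2\<bar>)))"
    using main by (intro has_bochner_integral_density) (auto simp: f_LB_nonneg)
  then have "has_bochner_integral M (\<lambda>\<omega>. g (L \<omega>)) (complex_of_real (Digamma (1/2 + \<bar>x - 1/2\<bar>)))"
    unfolding distr[symmetric] by (simp add: has_bochner_integral_iff integrable_distr_eq integral_distr)
  moreover have "bernoulli_umbra Ln x = (\<integral>u. f_LB u *\<^sub>R g u \<partial>lborel)"
    unfolding bernoulli_umbra_def g_def by (simp add: scaleR_conv_of_real mult.commute)
  ultimately show ?thesis
    using main unfolding g_def by (simp add: has_bochner_integral_iff)
qed

end
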